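(* Let $K\ge1$. Suppose that $f(z)=h(z)+\overline{g(z)}=\sum_{n=0}^\infty a_nz^n+\overline{\sum_{n=1}^\infty b_nz^n}$ is a sense-preserving $K$-quasiconformal harmonic mapping in $\mathbb{D}$ and $h\prec\phi$, where $\phi$ is univalent and convex in $\mathbb{D}$. Then $$|h(z)|+|h'(z)|r+\sum_{n=2}^\infty|a_n|r^n+\sum_{n=1}^\infty|b_n|r^n\le|\phi(0)|+d(\phi(0),\partial\phi(\mathbb{D}))\quad\text{for } |z|=r\le r_0,$$ where $r_0\in(0,1)$ is the smallest positive root of the equation $$(1-r)^2-2\left(r^2+\left(\frac{2K}{K+1}\right)r\right)(1-r)-2r=0.$$ The number $r_0$ is sharp: for given $K$ it cannot be replaced by any larger number for which the inequality holds for all such $f$ and $\phi$.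
   Context: $\mathbb{D}=\{z\in\mathbb{C}:|z|<1\}$. A harmonic mapping in $\mathbb{D}$ is written $f=h+\overline{g}$ with $h,g$ analytic in $\mathbb{D}$. It is locally univalent and sense-preserving if $h'\neq0$ in $\mathbb{D}$ and the dilatation $\omega=g'/h'$ satisfies $|\omega|<1$ in $\mathbb{D}$. Such an $f$ is called $K$-quasiconformal for $K\ge1$ if $|\omega(z)|\le k<1$ for all $z\in\mathbb{D}$, where $K=(1+k)/(1-k)$, i.e. $k=(K-1)/(K+1)$. For analytic $h,\phi$ in $\mathbb{D}$, $h\prec\phi$ (subordination) means $h=\phi\circ w$ for some analytic $w:\mathbb{D}\to\mathbb{D}$ with $w(0)=0$. "Univalent and convex" means $\phi$ is analytic and injective on $\mathbb{D}$ and $\phi(\mathbb{D})$ is a convex domain. $d(\phi(0),\partial\phi(\mathbb{D}))$ is the Euclidean distance from $\phi(0)$ to the boundary of $\phi(\mathbb{D})$. *)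

theory Defs
  imports "HOL-Complex_Analysis.Complex_Analysis"
begin

abbreviation unit_disc :: "complex set" where
  "unit_disc \<equiv> ball 0 1"

text \<open>A harmonic mapping is carried together with its analytic part \<open>h\<close> and co-analytic part \<open>g\<close>.\<close>

definition harmonic_mapping ::
  "(complex \<Rightarrow> complex) \<Rightarrow> (complex \<Rightarrow> complex) \<Rightarrow> (complex \<Rightarrow> complex) \<Rightarrow> bool" where
  "harmonic_mapping f h g \<longleftrightarrow>
     h holomorphic_on unit_disc \<and> g holomorphic_on unit_disc \<and>
     (\<forall>z\<in>unit_disc. f z = h z + cnj (g z))"

definition dilatation :: "(complex \<Rightarrow> complex) \<Rightarrow> (complex \<Rightarrow> complex) \<Rightarrow> complex \<Rightarrow> complex" where
  "dilatation h g z = deriv g z / deriv h z"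

definition sense_preserving :: "(complex \<Rightarrow> complex) \<Rightarrow> (complex \<Rightarrow> complex) \<Rightarrow> bool" where
  "sense_preserving h g \<longleftrightarrow>
     (\<forall>z\<in>unit_disc. deriv h z \<noteq> 0 \<and> cmod (dilatation h g z) < 1)"

definition quasiconformal_harmonic ::
  "real \<Rightarrow> (complex \<Rightarrow> complex) \<Rightarrow> (complex \<Rightarrow> complex) \<Rightarrow> (complex \<Rightarrow> complex) \<Rightarrow> bool" where
  "quasiconformal_harmonic K f h g \<longleftrightarrow>
     harmonic_mapping f h g \<and> sense_preserving h g \<and>
     (\<forall>z\<in>unit_disc. cmod (dilatation h g z) \<le> (K - 1) / (K + 1))"

definition subordinate :: "(complex \<Rightarrow> complex) \<Rightarrow> (complex \<Rightarrow> complex) \<Rightarrow> bool" where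
  "subordinate h \<phi> \<longleftrightarrow>
     (\<exists>w. w holomorphic_on unit_disc \<and> w ` unit_disc \<subseteq> unit_disc \<and> w 0 = 0 \<and>
          (\<forall>z\<in>unit_disc. h z = \<phi> (w z)))"

definition univalent_convex :: "(complex \<Rightarrow> complex) \<Rightarrow> bool" where
  "univalent_convex \<phi> \<longleftrightarrow>
     \<phi> holomorphic_on unit_disc \<and> inj_on \<phi> unit_disc \<and> convex (\<phi> ` unit_disc)"

text \<open>The series of \<open>g\<close> starts at \<open>n = 1\<close>, so \<open>g 0 = 0\<close>, and the value \<open>b 0\<close> is irrelevant.\<close>

definition series_expansion ::
  "(complex \<Rightarrow> complex) \<Rightarrow> (complex \<Rightarrow> complex) \<Rightarrow> (nat \<Rightarrow> complex) \<Rightarrow> (nat \<Rightarrow> complex) \<Rightarrow> bool" where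
  "series_expansion h g a b \<longleftrightarrow>
     (\<forall>z\<in>unit_disc. (\<lambda>n. a n * z ^ n) sums h z \<and> (\<lambda>n. b (Suc n) * z ^ Suc n) sums g z)"

text \<open>The two real series converge for every \<open>z\<close> in the disc, as the power series of \<open>h\<close> and \<open>g\<close>
  converge absolutely there, so their sums are never the default value of \<open>suminf\<close>.\<close>

definition bohr_inequality ::
  "(complex \<Rightarrow> complex) \<Rightarrow> (nat \<Rightarrow> complex) \<Rightarrow> (nat \<Rightarrow> complex) \<Rightarrow> (complex \<Rightarrow> complex) \<Rightarrow> complex \<Rightarrow> bool" where
  "bohr_inequality h a b \<phi> z \<longleftrightarrow>
     cmod (h z) + cmod (deriv h z) * cmod z
       + (\<Sum>n. cmod (a (n + 2)) * cmod z ^ (n + 2))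
       + (\<Sum>n. cmod (b (n + 1)) * cmod z ^ (n + 1))
     \<le> cmod (\<phi> 0) + infdist (\<phi> 0) (frontier (\<phi> ` unit_disc))"

definition bohr_inequality_up_to :: "real \<Rightarrow> real \<Rightarrow> bool" where
  "bohr_inequality_up_to K R \<longleftrightarrow>
     (\<forall>f h g a b \<phi>.
        quasiconformal_harmonic K f h g \<longrightarrow> series_expansion h g a b \<longrightarrow>
        univalent_convex \<phi> \<longrightarrow> subordinate h \<phi> \<longrightarrow>
        (\<forall>z\<in>unit_disc. cmod z \<le> R \<longrightarrow> bohr_inequality h a b \<phi> z))"

definition radius_equation :: "real \<Rightarrow> real \<Rightarrow> bool" where
  "radius_equation K r \<longleftrightarrow>
     (1 - r)^2 - 2 * (r^2 + (2 * K / (K + 1)) * r) * (1 - r) - 2 * r = 0"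

end

theory Submission
  imports Defs
begin

text \<open>
  Let \<open>d\<close> be the distance from \<open>\<phi> 0\<close> to the boundary of the convex domain \<open>\<phi> ` unit_disc\<close>. The
  supporting line at a nearest boundary point confines \<open>h\<close> to a half-plane whose boundary is at
  distance at most \<open>d\<close> from \<open>h 0 = \<phi> 0\<close>, so Caratheodory's inequality gives \<open>\<bar>a n\<bar> \<le> 2 d\<close> for
  \<open>n \<ge> 1\<close>. The coefficients of \<open>g\<close> are those of \<open>g' = \<omega> h'\<close>, and for \<open>r \<le> 1/3\<close> Bohr's theorem bounds
  the majorant series of \<open>\<omega>\<close> by \<open>k = (K - 1) / (K + 1)\<close>. Summing geometric series turns the
  left-hand side into at most \<open>\<bar>\<phi> 0\<bar> + d M r\<close>, where \<open>M r = 1\<close> is the radius equation; its root lies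
  below \<open>1/3\<close>. All estimates are equalities at positive \<open>z\<close> for \<open>h z = \<phi> z = z / (1 - z)\<close> and
  \<open>g = k h\<close>.
\<close>

section \<open>Taylor coefficients and Caratheodory's inequality\<close>

lemma power_series_coeff_unique:
  assumes "\<And>z. z \<in> unit_disc \<Longrightarrow> (\<lambda>n. a n * z ^ n) sums f z"
    and "\<And>z. z \<in> unit_disc \<Longrightarrow> (\<lambda>n. b n * z ^ n) sums f z"
  shows "a = (b :: nat \<Rightarrow> complex)"
proof -
  have ev: "eventually (\<lambda>z. z \<in> unit_disc) (nhds (0::complex))"
    by (intro eventually_nhds_in_open) auto
  have "f has_fps_expansion Abs_fps a" "f has_fps_expansion Abs_fps b"
    by (rule has_fps_expansionI, rule eventually_mono[OF ev], use assms in simp)+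
  then have "Abs_fps a = Abs_fps b"
    using fps_expansion_unique_complex by blast
  then show ?thesis
    by (metis ext fps_nth_Abs_fps)
qed

text \<open>Cauchy's formula and Cauchy's theorem as Fourier integrals over \<open>{0..1}\<close>:
  on the circle \<open>dz = 2 * pi * \<i> * z dt\<close>, so one power of \<open>\<gamma>\<close>
  and the factor \<open>2 * pi * \<i>\<close> cancel. Nonnegative indices give the Taylor
  coefficients; negative ones give 0.\<close>

lemma higher_deriv_circle_integrals:
  assumes hol: "f holomorphic_on unit_disc" and s: "0 < s" "s < 1"
  defines "\<gamma> \<equiv> circlepath 0 s"
  shows "((\<lambda>t. f (\<gamma> t) / \<gamma> t ^ n) has_integral (deriv ^^ n) f 0 / fact n) {0..1}"
    and "((\<lambda>t. f (\<gamma> t) * \<gamma> t ^ Suc n) has_integral 0) {0..1}"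
proof -
  have hol': "f holomorphic_on cball 0 s"
    using hol by (rule holomorphic_on_subset) (use s in auto)
  have vd: "vector_derivative \<gamma> (at t) = 2 * pi * \<i> * \<gamma> t" for t
    unfolding \<gamma>_def vector_derivative_circlepath by (simp add: circlepath)
  have nz: "\<gamma> t \<noteq> 0" for t
    using s by (simp add: \<gamma>_def circlepath)
  have "((\<lambda>u. f u / (u - 0) ^ Suc n) has_contour_integral (2 * pi * \<i>) / fact n * (deriv ^^ n) f 0) \<gamma>"
    unfolding \<gamma>_def
    using s hol' by (intro Cauchy_has_contour_integral_higher_derivative_circlepath)
      (auto intro: holomorphic_on_imp_continuous_on holomorphic_on_subset)
  then have "((\<lambda>t. (f (\<gamma> t) / \<gamma> t ^ Suc n * (2 * pi * \<i> * \<gamma> t)) / (2 * pi * \<i>))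
      has_integral ((2 * pi * \<i>) / fact n * (deriv ^^ n) f 0) / (2 * pi * \<i>)) {0..1}"
    unfolding has_contour_integral vd by (intro has_integral_divide) simp
  then show "((\<lambda>t. f (\<gamma> t) / \<gamma> t ^ n) has_integral (deriv ^^ n) f 0 / fact n) {0..1}"
    using nz by (simp add: mult.commute)
  have "((\<lambda>u. f u * u ^ n) has_contour_integral 0) \<gamma>"
    by (rule Cauchy_theorem_convex_simple[where S = "cball 0 s"])
       (use s in \<open>auto simp: \<gamma>_def intro!: holomorphic_intros hol'\<close>)
  then have "((\<lambda>t. (f (\<gamma> t) * \<gamma> t ^ n * (2 * pi * \<i> * \<gamma> t)) / (2 * pi * \<i>))
      has_integral 0 / (2 * pi * \<i>)) {0..1}"
    unfolding has_contour_integral vd by (intro has_integral_divide) simp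
  then show "((\<lambda>t. f (\<gamma> t) * \<gamma> t ^ Suc n) has_integral 0) {0..1}"
    by (simp add: mult_ac)
qed

text \<open>For \<open>n > 0\<close>, integrating \<open>2 * Re f\<close> against
  \<open>1 / \<gamma> ^ n\<close> over the circle of radius \<open>s\<close> gives
  \<open>c n\<close>, and its mean is \<open>2 * Re (c 0)\<close>. As \<open>2 * Re f\<close> is
  nonnegative, the integral triangle inequality yields
  \<open>cmod (c n) * s ^ n \<le> 2 * Re (c 0)\<close>; then \<open>s\<close> tends to 1.\<close>

lemma Caratheodory_coeff_bound:
  assumes hol: "f holomorphic_on unit_disc"
    and re: "\<And>z. z \<in> unit_disc \<Longrightarrow> Re (f z) \<ge> 0"
    and sums: "\<And>z. z \<in> unit_disc \<Longrightarrow> (\<lambda>n. c n * z ^ n) sums f z"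
    and n: "n > 0"
  shows "cmod (c n) \<le> 2 * Re (c 0)"
proof -
  have c: "c n = (deriv ^^ n) f 0 / fact n" for n
  proof -
    have "c = (\<lambda>n. (deriv ^^ n) f 0 / fact n)"
      using sums holomorphic_power_series[OF hol]
      by (intro power_series_coeff_unique[where f = f]) auto
    then show ?thesis by (rule fun_cong)
  qed
  have le: "cmod (c n) * s ^ n \<le> 2 * Re (c 0)" if s: "0 < s" "s < 1" for s
  proof -
    define \<gamma> where "\<gamma> = circlepath 0 s"
    obtain m where m: "n = Suc m" using n by (cases n) auto
    have nz: "\<gamma> t \<noteq> 0" and cm: "cmod (\<gamma> t) = s" for t
      using s by (auto simp: \<gamma>_def circlepath norm_mult)
    \<comment> \<open>On the circle of radius \<open>s\<close> conjugation is inversion, which turns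
      a conjugated positive power of \<open>\<gamma> t\<close> into a negative power.\<close>
    have cnj: "cnj (\<gamma> t) = of_real (s\<^sup>2) / \<gamma> t" for t
      using nz[of t] cm[of t] complex_norm_square[of "\<gamma> t"] by (simp add: field_simps)
    \<comment> \<open>The conjugate of \<open>f\<close> has no Fourier coefficient of index \<open>n > 0\<close>, so \<open>c n\<close> is also a
      Fourier coefficient of the nonnegative function \<open>2 Re f\<close>.\<close>
    note ints = higher_deriv_circle_integrals[OF hol s, folded \<gamma>_def c]
    have "((\<lambda>t. cnj (f (\<gamma> t)) * cnj (\<gamma> t) ^ n) has_integral 0) {0..1}"
      using ints(2)[of m] has_integral_cnj[of "\<lambda>t. f (\<gamma> t) * \<gamma> t ^ n" 0 "{0..1}"]
      by (simp add: m o_def)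
    then have "((\<lambda>t. cnj (f (\<gamma> t)) * cnj (\<gamma> t) ^ n / of_real (s\<^sup>2) ^ n) has_integral 0 / of_real (s\<^sup>2) ^ n) {0..1}"
      by (rule has_integral_divide)
    then have "((\<lambda>t. cnj (f (\<gamma> t)) / \<gamma> t ^ n) has_integral 0) {0..1}"
      using s by (simp add: cnj power_divide)
    from has_integral_add[OF ints(1)[of n] this]
    have "((\<lambda>t. of_real (2 * Re (f (\<gamma> t))) / \<gamma> t ^ n) has_integral c n) {0..1}"
      by (simp add: complex_add_cnj add_divide_distrib[symmetric])
    \<comment> \<open>The dominating function: since \<open>Re f \<ge> 0\<close>, its real part
      equals the norm of the integrand above, and the mean value property gives its
      integral.\<close>
    moreover have "((\<lambda>t. f (\<gamma> t) * of_real (2 / s ^ n)) has_integral c 0 * of_real (2 / s ^ n)) {0..1}"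
      using ints(1)[of 0] by (intro has_integral_mult_left) simp
    moreover have "\<gamma> t \<in> unit_disc" for t
      using cm s by simp
    ultimately have "cmod (c n) \<le> (c 0 * of_real (2 / s ^ n)) \<bullet> 1"
      using re s
      by (elim has_integral_norm_bound_integral_component)
         (auto simp: norm_divide norm_power cm norm_mult divide_simps)
    then show ?thesis using s by (simp add: field_simps)
  qed
  have "((\<lambda>s. cmod (c n) * s ^ n) \<longlongrightarrow> cmod (c n) * 1 ^ n) (at_left 1)"
    by (intro tendsto_intros)
  moreover have "eventually (\<lambda>s. cmod (c n) * s ^ n \<le> 2 * Re (c 0)) (at_left 1)"
    using eventually_at_left_real[of 0 1] by (auto elim!: eventually_mono intro: le)
  ultimately show ?thesis
    by (intro tendsto_upperbound[of _ _ "at_left (1::real)"]) auto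
qed

text \<open>The affine map \<open>x \<mapsto> u * (x - p)\<close> carries a half-plane with
  \<open>p\<close> on its boundary to the right half-plane. It multiplies every coefficient by the
  unimodular \<open>u\<close>, and the shift by \<open>p\<close> affects the constant one
  alone.\<close>

lemma Caratheodory_rotated:
  assumes hol: "f holomorphic_on unit_disc"
    and re: "\<And>z. z \<in> unit_disc \<Longrightarrow> Re (u * (f z - p)) \<ge> 0"
    and sums: "\<And>z. z \<in> unit_disc \<Longrightarrow> (\<lambda>n. c n * z ^ n) sums f z"
    and u: "cmod u = 1" and n: "n > 0"
  shows "cmod (c n) \<le> 2 * Re (u * (c 0 - p))"
proof -
  define d where "d = (\<lambda>n. u * (c n - (if n = 0 then p else 0)))"
  have "(\<lambda>n. d n * z ^ n) sums (u * (f z - p))" if "z \<in> unit_disc" for z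
  proof -
    have "(\<lambda>n. (if n = 0 then p else 0)) sums p"
      using sums_single[of 0 "\<lambda>_. p"] by simp
    from sums_mult[OF sums_diff[OF sums[OF that] this], of u] show ?thesis
      by (rule back_subst[where P = "\<lambda>f. f sums _"]) (auto simp: d_def algebra_simps)
  qed
  then have "cmod (d n) \<le> 2 * Re (d 0)"
    using re n hol by (intro Caratheodory_coeff_bound[of "\<lambda>z. u * (f z - p)"]) (auto intro!: holomorphic_intros)
  then show ?thesis using u n by (simp add: d_def norm_mult)
qed

section \<open>Majorant series and Bohr's theorem\<close>

lemma power_series_abs_summable:
  assumes "\<And>z. z \<in> unit_disc \<Longrightarrow> (\<lambda>n. c n * z ^ n) sums f z" and "0 \<le> r" "r < 1"
  shows "summable (\<lambda>n. cmod (c n) * r ^ n)"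
proof -
  \<comment> \<open>Convergence at a point of larger modulus, here the midpoint of \<open>r\<close>
    and 1, forces absolute convergence at \<open>r\<close>.\<close>
  have "complex_of_real ((r + 1) / 2) \<in> unit_disc"
    using assms by (simp only: mem_ball_0 norm_of_real) simp
  from sums_summable[OF assms(1)[OF this]]
  have "summable (\<lambda>n. cmod (c n * of_real r ^ n))"
    by (rule powser_insidea) (use assms in \<open>simp only: norm_of_real; simp\<close>)
  then show ?thesis using assms by (simp add: norm_mult norm_power)
qed

text \<open>After a rotation making \<open>c 0\<close> nonnegative, the half-plane
  \<open>Re x \<le> k\<close> contains all values, so every later coefficient is at most
  \<open>2 * (k - cmod (c 0))\<close>. The geometric series then contributes at most
  \<open>k - cmod (c 0)\<close>.\<close>

theorem Bohr_inequality:
  assumes hol: "f holomorphic_on unit_disc"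
    and bnd: "\<And>z. z \<in> unit_disc \<Longrightarrow> cmod (f z) \<le> k"
    and sums: "\<And>z. z \<in> unit_disc \<Longrightarrow> (\<lambda>n. c n * z ^ n) sums f z"
    and r: "0 \<le> r" "r \<le> 1/3"
  shows "(\<Sum>n. cmod (c n) * r ^ n) \<le> k"
proof -
  obtain v where v: "cmod v = 1" "v * c 0 = of_real (cmod (c 0))"
  proof (cases "c 0 = 0")
    case True then show ?thesis using that[of 1] by simp
  next
    case False
    then show ?thesis using that[of "of_real (cmod (c 0)) / c 0"] by (simp add: norm_divide)
  qed
  have le: "cmod (c (Suc n)) \<le> 2 * (k - cmod (c 0))" for n
  proof -
    \<comment> \<open>The normal \<open>- v\<close> and the boundary point \<open>k / v\<close>
      describe the half-plane \<open>Re (v * x) \<le> k\<close>.\<close>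
    have "cmod (c (Suc n)) \<le> 2 * Re (- v * (c 0 - of_real k / v))"
    proof (rule Caratheodory_rotated[OF hol _ sums])
      fix z :: complex assume "z \<in> unit_disc"
      then have "Re (v * f z) \<le> k"
        using bnd[of z] complex_Re_le_cmod[of "v * f z"] v by (simp add: norm_mult)
      then show "0 \<le> Re (- v * (f z - of_real k / v))"
        using v by (auto simp: algebra_simps)
    qed (use v in auto)
    also have "- v * (c 0 - of_real k / v) = of_real (k - cmod (c 0))"
      using v by (auto simp: algebra_simps)
    finally show ?thesis by simp
  qed
  have k: "cmod (c 0) \<le> k" using order_trans[OF norm_ge_zero le] by simp
  have sm: "summable (\<lambda>n. cmod (c n) * r ^ n)"
    using power_series_abs_summable[OF sums] r by simp
  have g: "(\<lambda>n. 2 * (k - cmod (c 0)) * r * r ^ n) sums (2 * (k - cmod (c 0)) * r * (1 / (1 - r)))"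
    using r by (intro sums_mult geometric_sums) simp
  have "(\<Sum>n. cmod (c (Suc n)) * r ^ Suc n) \<le> 2 * (k - cmod (c 0)) * r * (1 / (1 - r))"
    unfolding sums_unique[OF g]
  proof (rule suminf_le)
    fix n
    show "cmod (c (Suc n)) * r ^ Suc n \<le> 2 * (k - cmod (c 0)) * r * r ^ n"
      using mult_right_mono[OF le[of n], of "r ^ Suc n"] r by (simp add: mult_ac)
  next
    show "summable (\<lambda>n. cmod (c (Suc n)) * r ^ Suc n)"
      using sm by (subst summable_Suc_iff)
  qed (rule sums_summable[OF g])
  also have "\<dots> = (k - cmod (c 0)) * (2 * r / (1 - r))"
    by simp
  \<comment> \<open>For \<open>r < 1\<close>, the bound \<open>2 * r / (1 - r) \<le> 1\<close>
    amounts to \<open>r \<le> 1/3\<close>: Bohr's constant.\<close>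
  also have "\<dots> \<le> (k - cmod (c 0)) * 1"
    using r k by (intro mult_left_mono) (auto simp: field_simps)
  finally show ?thesis
    using suminf_split_head[OF sm] by simp
qed


section \<open>Coefficients of the co-analytic part\<close>

text \<open>Comparing coefficients in \<open>g' = \<omega> * h'\<close> writes
  \<open>(n + 1) * b (n + 1)\<close> as the sum of \<open>c i * (n - i + 1) * a (n - i + 1)\<close>.
  Hence the majorant of \<open>g\<close> is at most the product of those of \<open>\<omega>\<close>
  and of \<open>h - h 0\<close>, and Bohr's theorem bounds the former by \<open>k\<close>.\<close>

lemma coanalytic_coeff_sum_bound:
  assumes hol: "h holomorphic_on unit_disc" "g holomorphic_on unit_disc"
    and nz: "\<And>z. z \<in> unit_disc \<Longrightarrow> deriv h z \<noteq> 0"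
    and dil: "\<And>z. z \<in> unit_disc \<Longrightarrow> cmod (dilatation h g z) \<le> k"
    and a: "\<And>z. z \<in> unit_disc \<Longrightarrow> (\<lambda>n. a n * z ^ n) sums h z"
    and b: "\<And>z. z \<in> unit_disc \<Longrightarrow> (\<lambda>n. b n * z ^ n) sums g z"
    and r: "0 \<le> r" "r \<le> 1/3"
  shows "(\<Sum>n. cmod (b (Suc n)) * r ^ Suc n) \<le> k * (\<Sum>n. cmod (a (Suc n)) * r ^ Suc n)"
proof -
  define c where "c = (\<lambda>n. (deriv ^^ n) (dilatation h g) 0 / fact n)"
  have hol_dil: "dilatation h g holomorphic_on unit_disc"
    unfolding dilatation_def[abs_def] using hol nz by (intro holomorphic_intros) auto
  have c: "(\<lambda>n. c n * z ^ n) sums dilatation h g z" if "z \<in> unit_disc" for z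
    using holomorphic_power_series[OF hol_dil that] by (simp add: c_def)
  have diff: "(f has_field_derivative deriv f z) (at z)"
    if "f holomorphic_on unit_disc" "z \<in> unit_disc" for f z
    using holomorphic_derivI[OF that(1) open_ball that(2)] .
  have da: "(\<lambda>n. diffs a n * z ^ n) sums deriv h z" if "z \<in> unit_disc" for z
    using a diff[OF hol(1) that] that by (intro termdiffs_sums_strong[where K = 1]) auto
  have db: "(\<lambda>n. diffs b n * z ^ n) sums deriv g z" if "z \<in> unit_disc" for z
    using b diff[OF hol(2) that] that by (intro termdiffs_sums_strong[where K = 1]) auto
  have abs: "summable (\<lambda>n. cmod (e n * z ^ n))"
    if "\<And>z. z \<in> unit_disc \<Longrightarrow> (\<lambda>n. e n * z ^ n) sums f z" "z \<in> unit_disc" for e f z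
    using power_series_abs_summable[OF that(1), of "cmod z"] that(2) by (simp add: norm_mult norm_power)
  have prod: "(\<lambda>n. (\<Sum>i\<le>n. c i * diffs a (n - i)) * z ^ n) sums deriv g z"
    if z: "z \<in> unit_disc" for z
  proof -
    have "(\<lambda>n. \<Sum>i\<le>n. (c i * z ^ i) * (diffs a (n - i) * z ^ (n - i))) sums
        ((\<Sum>n. c n * z ^ n) * (\<Sum>n. diffs a n * z ^ n))"
      using abs[OF c z] abs[OF da z] by (rule Cauchy_product_sums)
    moreover have "(\<Sum>i\<le>n. (c i * z ^ i) * (diffs a (n - i) * z ^ (n - i)))
        = (\<Sum>i\<le>n. c i * diffs a (n - i)) * z ^ n" for n
      unfolding sum_distrib_right
    proof (rule sum.cong[OF refl])
      fix i assume "i \<in> {..n}"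
      then have "z ^ n = z ^ i * z ^ (n - i)" by (simp flip: power_add)
      then show "(c i * z ^ i) * (diffs a (n - i) * z ^ (n - i)) = c i * diffs a (n - i) * z ^ n"
        by (simp add: mult_ac)
    qed
    ultimately show ?thesis
      using nz[OF z] unfolding sums_unique[OF c[OF z], symmetric] sums_unique[OF da[OF z], symmetric]
      by (simp add: dilatation_def)
  qed
  have coeff: "diffs b n = (\<Sum>i\<le>n. c i * diffs a (n - i))" for n
    using power_series_coeff_unique[OF db prod] by (rule fun_cong)
  have b_le: "cmod (b (Suc n)) \<le> (\<Sum>i\<le>n. cmod (c i) * cmod (a (Suc (n - i))))" for n
  proof -
    have "real (Suc n) * cmod (b (Suc n)) = cmod (\<Sum>i\<le>n. c i * diffs a (n - i))"
      unfolding coeff[symmetric] by (simp add: diffs_def norm_mult del: of_nat_Suc)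
    also have "\<dots> \<le> (\<Sum>i\<le>n. cmod (c i * diffs a (n - i)))"
      by (rule norm_sum)
    also have "\<dots> \<le> (\<Sum>i\<le>n. real (Suc n) * (cmod (c i) * cmod (a (Suc (n - i)))))"
    proof (rule sum_mono)
      fix i
      \<comment> \<open>The weight \<open>n - i + 1\<close> from differentiating \<open>h\<close> is
        at most the weight \<open>n + 1\<close> from differentiating \<open>g\<close>, so the
        weights can be cancelled.\<close>
      have "real (Suc (n - i)) * (cmod (c i) * cmod (a (Suc (n - i))))
          \<le> real (Suc n) * (cmod (c i) * cmod (a (Suc (n - i))))"
        by (intro mult_right_mono) auto
      then show "cmod (c i * diffs a (n - i)) \<le> real (Suc n) * (cmod (c i) * cmod (a (Suc (n - i))))"
        by (simp add: diffs_def norm_mult mult_ac del: of_nat_Suc)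
    qed
    also have "\<dots> = real (Suc n) * (\<Sum>i\<le>n. cmod (c i) * cmod (a (Suc (n - i))))"
      by (simp add: sum_distrib_left)
    finally show ?thesis by (subst (asm) mult_le_cancel_left_pos) simp_all
  qed
  have r1: "r < 1" using r by simp
  have sa: "summable (\<lambda>n. cmod (a (Suc n)) * r ^ Suc n)"
    using power_series_abs_summable[OF a r(1) r1] by (subst summable_Suc_iff)
  have sb: "summable (\<lambda>n. cmod (b (Suc n)) * r ^ Suc n)"
    using power_series_abs_summable[OF b r(1) r1] by (subst summable_Suc_iff)
  have sc: "summable (\<lambda>n. cmod (c n) * r ^ n)"
    by (rule power_series_abs_summable[OF c r(1) r1])
  have conv: "(\<lambda>n. \<Sum>i\<le>n. (cmod (c i) * r ^ i) * (cmod (a (Suc (n - i))) * r ^ Suc (n - i))) sums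
        ((\<Sum>n. cmod (c n) * r ^ n) * (\<Sum>n. cmod (a (Suc n)) * r ^ Suc n))"
    using sa sc r by (intro Cauchy_product_sums) (simp_all add: abs_mult)
  have "(\<Sum>n. cmod (b (Suc n)) * r ^ Suc n) \<le>
      (\<Sum>n. \<Sum>i\<le>n. (cmod (c i) * r ^ i) * (cmod (a (Suc (n - i))) * r ^ Suc (n - i)))"
  proof (rule suminf_le[OF _ sb sums_summable[OF conv]])
    fix n
    have "cmod (b (Suc n)) * r ^ Suc n
        \<le> (\<Sum>i\<le>n. cmod (c i) * cmod (a (Suc (n - i)))) * r ^ Suc n"
      using b_le r by (intro mult_right_mono) auto
    also have "\<dots> = (\<Sum>i\<le>n. (cmod (c i) * r ^ i) * (cmod (a (Suc (n - i))) * r ^ Suc (n - i)))"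
      unfolding sum_distrib_right
    proof (rule sum.cong[OF refl])
      fix i assume "i \<in> {..n}"
      then have "r ^ Suc n = r ^ i * r ^ Suc (n - i)" by (simp add: Suc_diff_le flip: power_add)
      then show "cmod (c i) * cmod (a (Suc (n - i))) * r ^ Suc n =
          (cmod (c i) * r ^ i) * (cmod (a (Suc (n - i))) * r ^ Suc (n - i))"
        by (simp only: mult_ac)
    qed
    finally show "cmod (b (Suc n)) * r ^ Suc n \<le> \<dots>" .
  qed
  also have "\<dots> = (\<Sum>n. cmod (c n) * r ^ n) * (\<Sum>n. cmod (a (Suc n)) * r ^ Suc n)"
    using sums_unique[OF conv] by simp
  also have "\<dots> \<le> k * (\<Sum>n. cmod (a (Suc n)) * r ^ Suc n)"
    using sa r by (intro mult_right_mono Bohr_inequality[OF hol_dil dil c] suminf_nonneg) auto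
  finally show ?thesis .
qed

section \<open>Supporting half-planes of convex images\<close>

text \<open>Otherwise the inverse would be a bounded entire function, against Liouville. This makes
  the frontier of the image nonempty, so \<open>infdist\<close> is a genuine distance and not its
  default value 0.\<close>

lemma injective_image_unit_disc_ne_UNIV:
  assumes "\<phi> holomorphic_on unit_disc" "inj_on \<phi> unit_disc"
  shows "\<phi> ` unit_disc \<noteq> UNIV"
proof
  assume U: "\<phi> ` unit_disc = UNIV"
  obtain \<psi> where \<psi>: "\<psi> holomorphic_on UNIV" "\<And>z. z \<in> unit_disc \<Longrightarrow> \<psi> (\<phi> z) = z"
    using holomorphic_has_inverse[OF assms(1) open_ball assms(2)] U by metis
  have "range \<psi> \<subseteq> unit_disc"
    unfolding U[symmetric] using \<psi>(2) by auto
  then have "bounded (range \<psi>)" by (rule bounded_subset[OF bounded_ball])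
  with \<psi>(1) have "\<psi> constant_on UNIV" by (rule Liouville_theorem)
  then have "\<psi> (\<phi> 0) = \<psi> (\<phi> (1/2))" by (auto simp: constant_on_def)
  then show False using \<psi>(2)[of 0] \<psi>(2)[of "1/2"] by simp
qed

text \<open>A line separating the nearest frontier point \<open>p\<close> from the open convex set
  yields a half-plane with \<open>p\<close> on its boundary that contains the set.\<close>

lemma nearest_supporting_halfplane:
  fixes S :: "complex set"
  assumes S: "open S" "convex S" "S \<noteq> UNIV" and q: "q \<in> S"
  obtains u p where "cmod u = 1" "cmod (q - p) = infdist q (frontier S)"
    "\<And>x. x \<in> S \<Longrightarrow> Re (u * (x - p)) \<ge> 0"
proof -
  have "frontier S \<noteq> {}" using S q by (auto simp: frontier_eq_empty)
  then obtain p where p: "p \<in> frontier S" "infdist q (frontier S) = dist q p"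
    using infdist_attains_inf[OF frontier_closed] by metis
  have "p \<notin> S" using p S(1) by (simp add: frontier_def interior_open)
  then obtain v \<beta> where v: "v \<noteq> 0" "v \<bullet> p \<le> \<beta>" "\<And>x. x \<in> S \<Longrightarrow> \<beta> \<le> v \<bullet> x"
    using separating_hyperplane_sets[of "{p}" S] S(2) q by auto
  \<comment> \<open>The real inner product \<open>v \<bullet> x\<close> is
    \<open>Re (cnj v * x)\<close>; dividing by \<open>cmod v\<close> normalises it.\<close>
  define u where "u = cnj v / of_real (cmod v)"
  show ?thesis
  proof (rule that[of u p])
    show "cmod u = 1" using v(1) by (simp add: u_def norm_divide)
    show "cmod (q - p) = infdist q (frontier S)" using p(2) by (simp add: dist_norm)
    fix x assume "x \<in> S"
    then have "v \<bullet> (x - p) \<ge> 0" using v(2) v(3)[of x] by (simp add: inner_diff_right)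
    moreover have "Re (u * (x - p)) = (v \<bullet> (x - p)) / cmod v"
      by (simp add: u_def inner_complex_def add_divide_distrib diff_divide_distrib)
    ultimately show "Re (u * (x - p)) \<ge> 0" by simp
  qed
qed

text \<open>Subordination gives two facts: \<open>h\<close> takes its values in the image of
  \<open>\<phi>\<close>, hence in the half-plane, and \<open>a 0 = \<phi> 0\<close>, whose distance
  to \<open>p\<close> is the required \<open>infdist\<close>.\<close>

lemma subordinate_convex_coeff_bound:
  assumes \<phi>: "univalent_convex \<phi>" and sub: "subordinate h \<phi>"
    and hol: "h holomorphic_on unit_disc"
    and a: "\<And>z. z \<in> unit_disc \<Longrightarrow> (\<lambda>n. a n * z ^ n) sums h z"
    and n: "n > 0"
  shows "cmod (a n) \<le> 2 * infdist (\<phi> 0) (frontier (\<phi> ` unit_disc))"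
proof -
  let ?S = "\<phi> ` unit_disc"
  from \<phi> have hol_\<phi>: "\<phi> holomorphic_on unit_disc" and inj: "inj_on \<phi> unit_disc" and conv: "convex ?S"
    by (auto simp: univalent_convex_def)
  have "open ?S" using open_mapping_thm3[OF hol_\<phi> open_ball inj] .
  then obtain u p where u: "cmod u = 1"
      and p: "cmod (\<phi> 0 - p) = infdist (\<phi> 0) (frontier ?S)"
      and re: "\<And>x. x \<in> ?S \<Longrightarrow> Re (u * (x - p)) \<ge> 0"
    using nearest_supporting_halfplane[OF _ conv injective_image_unit_disc_ne_UNIV[OF hol_\<phi> inj], of "\<phi> 0"]
    by auto
  obtain w where w: "w ` unit_disc \<subseteq> unit_disc" "w 0 = 0" "\<And>z. z \<in> unit_disc \<Longrightarrow> h z = \<phi> (w z)"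
    using sub by (auto simp: subordinate_def)
  have "a 0 = h 0" using sums_unique2[OF powser_sums_zero a[of 0]] by simp
  then have a0: "a 0 = \<phi> 0" using w by simp
  have "cmod (a n) \<le> 2 * Re (u * (a 0 - p))"
    using w(1,3) by (intro Caratheodory_rotated[OF hol _ a u n] re) (auto simp: image_subset_iff)
  also have "\<dots> \<le> 2 * cmod (u * (a 0 - p))"
    by (intro mult_left_mono complex_Re_le_cmod) simp
  finally show ?thesis by (simp add: norm_mult u a0 p)
qed


section \<open>The radius equation\<close>

text \<open>The radius equation divided by \<open>(1 - r)\<^sup>2\<close>, which makes monotonicity visible.\<close>

definition bohr_majorant :: "real \<Rightarrow> real \<Rightarrow> real" where
  "bohr_majorant K r = 2 * r / (1 - r)^2 + 2 * (r^2 + (2 * K / (K + 1)) * r) / (1 - r)"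

lemma radius_equation_iff:
  assumes "r < 1"
  shows "radius_equation K r \<longleftrightarrow> bohr_majorant K r = 1"
proof -
  have "bohr_majorant K r =
      (2 * r + 2 * (r^2 + (2 * K / (K + 1)) * r) * (1 - r)) / (1 - r)^2"
    using assms by (simp add: bohr_majorant_def add_divide_distrib power2_eq_square)
  moreover have "(1 - r)^2 \<noteq> 0" using assms by simp
  ultimately show ?thesis
    unfolding radius_equation_def by (auto simp: divide_eq_1_iff)
qed

text \<open>In both fractions the numerator grows and the denominator shrinks. It follows that the
  root is unique in the unit interval and that the majorant exceeds 1 beyond it.\<close>

lemma bohr_majorant_strict_mono:
  assumes "K \<ge> 1" "0 \<le> r" "r < s" "s < 1"
  shows "bohr_majorant K r < bohr_majorant K s"
  unfolding bohr_majorant_def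
proof (rule add_less_le_mono)
  have "(1 - s)^2 \<le> (1 - r)^2" using assms by (intro power_mono) auto
  then show "2 * r / (1 - r)^2 < 2 * s / (1 - s)^2"
    using assms by (intro frac_less) auto
  show "2 * (r^2 + (2 * K / (K + 1)) * r) / (1 - r) \<le> 2 * (s^2 + (2 * K / (K + 1)) * s) / (1 - s)"
    using assms by (intro frac_le mult_left_mono add_mono power_mono) (auto intro!: add_nonneg_nonneg)
qed

text \<open>Intermediate value theorem: the majorant is 0 at 0, and its first summand alone is
  \<open>3/2\<close> at \<open>1/3\<close>. A root below \<open>1/3\<close> keeps Bohr's theorem
  applicable.\<close>

lemma bohr_radius_exists:
  assumes "K \<ge> 1"
  obtains r\<^sub>0 where "0 < r\<^sub>0" "r\<^sub>0 < 1/3" "bohr_majorant K r\<^sub>0 = 1"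
proof -
  have "continuous_on {0..1/3} (bohr_majorant K)"
    unfolding bohr_majorant_def by (intro continuous_intros) auto
  moreover have "bohr_majorant K 0 \<le> 1" by (simp add: bohr_majorant_def)
  moreover have gt: "1 < bohr_majorant K (1/3)"
    using assms by (simp add: bohr_majorant_def power2_eq_square field_simps)
  ultimately obtain r where r: "0 \<le> r" "r \<le> 1/3" "bohr_majorant K r = 1"
    using IVT'[of "bohr_majorant K" 0 1 "1/3"] by auto
  moreover have "r \<noteq> 0" using r by (auto simp: bohr_majorant_def)
  moreover have "r \<noteq> 1/3" using r(3) gt by (metis less_irrefl)
  ultimately show ?thesis by (intro that[of r]) auto
qed

section \<open>The upper estimate\<close>

lemma suminf_le_geometric:
  fixes c :: "nat \<Rightarrow> real"
  assumes "\<And>n. 0 \<le> c n" "\<And>n. c n \<le> M" "0 \<le> r" "r < 1"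
  shows "(\<Sum>n. c n * r ^ (n + m)) \<le> M * (r ^ m / (1 - r))"
proof -
  have g: "(\<lambda>n. M * r ^ m * r ^ n) sums (M * r ^ m * (1 / (1 - r)))"
    using assms by (intro sums_mult geometric_sums) simp
  have le: "c n * r ^ (n + m) \<le> M * r ^ m * r ^ n" for n
    using mult_right_mono[OF assms(2)[of n], of "r ^ (n + m)"] assms(3)
    by (simp add: power_add mult_ac)
  have "summable (\<lambda>n. c n * r ^ (n + m))"
    using le assms by (intro summable_comparison_test'[OF sums_summable[OF g]]) (simp add: abs_mult)
  then have "(\<Sum>n. c n * r ^ (n + m)) \<le> (\<Sum>n. M * r ^ m * r ^ n)"
    using le sums_summable[OF g] by (intro suminf_le)
  then show ?thesis using sums_unique[OF g] by simp
qed

text \<open>The four terms are estimated separately from \<open>cmod (a n) \<le> 2 * d\<close>;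
  their bounds add up to the majorant because \<open>2 * K / (K + 1) = 1 + k\<close>.\<close>

lemma bohr_sum_le_majorant:
  assumes K: "K \<ge> 1" and qc: "quasiconformal_harmonic K f h g"
    and series: "series_expansion h g a b"
    and \<phi>: "univalent_convex \<phi>" and sub: "subordinate h \<phi>"
    and z: "cmod z \<le> 1/3"
  shows "cmod (h z) + cmod (deriv h z) * cmod z
       + (\<Sum>n. cmod (a (n + 2)) * cmod z ^ (n + 2))
       + (\<Sum>n. cmod (b (n + 1)) * cmod z ^ (n + 1))
     \<le> cmod (\<phi> 0) + infdist (\<phi> 0) (frontier (\<phi> ` unit_disc)) * bohr_majorant K (cmod z)"
proof -
  define d where "d = infdist (\<phi> 0) (frontier (\<phi> ` unit_disc))"
  define r where "r = cmod z"
  define k where "k = (K - 1) / (K + 1)"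
  have r: "0 \<le> r" "r \<le> 1/3" "r < 1" using z by (auto simp: r_def)
  have zin: "z \<in> unit_disc" using r by (simp add: r_def)
  have k: "0 \<le> k" using K by (simp add: k_def)
  have hol: "h holomorphic_on unit_disc" "g holomorphic_on unit_disc"
    and nz: "\<And>z. z \<in> unit_disc \<Longrightarrow> deriv h z \<noteq> 0"
    and dil: "\<And>z. z \<in> unit_disc \<Longrightarrow> cmod (dilatation h g z) \<le> k"
    using qc by (auto simp: quasiconformal_harmonic_def harmonic_mapping_def sense_preserving_def k_def)
  have a: "(\<lambda>n. a n * z ^ n) sums h z" if "z \<in> unit_disc" for z
    using series that by (auto simp: series_expansion_def)
  \<comment> \<open>The expansion of \<open>g\<close> leaves \<open>b 0\<close> arbitrary; resetting
    it to 0 gives a full power series of \<open>g\<close>.\<close>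
  have b: "(\<lambda>n. (b(0 := 0)) n * z ^ n) sums g z" if "z \<in> unit_disc" for z
    using series that sums_Suc[of "\<lambda>n. (b(0 := 0)) n * z ^ n" "g z"]
    by (auto simp: series_expansion_def)
  have a_le: "cmod (a (n + 1)) \<le> 2 * d" for n
    unfolding d_def by (rule subordinate_convex_coeff_bound[OF \<phi> sub hol(1) a]) auto
  have a0: "a 0 = \<phi> 0"
    using sums_unique2[OF powser_sums_zero a[of 0]] sub by (auto simp: subordinate_def)
  define A where "A = (\<Sum>n. cmod (a (n + 1)) * r ^ (n + 1))"
  have A: "A \<le> 2 * d * (r / (1 - r))"
    unfolding A_def using suminf_le_geometric[of "\<lambda>n. cmod (a (n + 1))" "2 * d" r 1] a_le r by simp
  have abs: "summable (\<lambda>n. cmod (a n) * r ^ n)"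
    by (rule power_series_abs_summable[OF a r(1,3)])
  have "cmod (h z) \<le> (\<Sum>n. cmod (a n) * r ^ n)"
    using summable_norm[of "\<lambda>n. a n * z ^ n"] abs sums_unique[OF a[OF zin]]
    by (simp add: norm_mult norm_power r_def)
  also have "\<dots> = cmod (\<phi> 0) + A"
    using suminf_split_head[OF abs] by (simp add: A_def a0)
  finally have 1: "cmod (h z) \<le> cmod (\<phi> 0) + 2 * d * (r / (1 - r))"
    using A by linarith
  have "(h has_field_derivative deriv h z) (at z)"
    using holomorphic_derivI[OF hol(1) open_ball zin] .
  then have dh: "(\<lambda>n. diffs a n * z ^ n) sums deriv h z"
    using a zin by (intro termdiffs_sums_strong[where K = 1]) auto
  \<comment> \<open>The series of \<open>deriv h\<close> is dominated by the derivative of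
    \<open>2 * d * (r / (1 - r))\<close>.\<close>
  have dgeo: "(\<lambda>n. 2 * d * (real (Suc n) * r ^ n)) sums (2 * d * (1 / (1 - r)^2))"
    using r by (intro sums_mult geometric_deriv_sums) auto
  have "cmod (diffs a n * z ^ n) \<le> 2 * d * (real (Suc n) * r ^ n)" for n
    using mult_right_mono[OF a_le[of n], of "real (Suc n) * r ^ n"] r
    by (simp add: diffs_def norm_mult norm_power r_def mult_ac del: of_nat_Suc)
  from norm_suminf_le[OF this sums_summable[OF dgeo]]
  have "cmod (deriv h z) \<le> 2 * d * (1 / (1 - r)^2)"
    unfolding sums_unique[OF dh, symmetric] sums_unique[OF dgeo, symmetric] .
  from mult_right_mono[OF this r(1)]
  have 2: "cmod (deriv h z) * r \<le> d * (2 * r / (1 - r)^2)"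
    by (simp add: mult_ac)
  have 3: "(\<Sum>n. cmod (a (n + 2)) * r ^ (n + 2)) \<le> 2 * d * (r^2 / (1 - r))"
    using suminf_le_geometric[of "\<lambda>n. cmod (a (n + 2))" "2 * d" r 2] a_le[of "Suc _"] r by simp
  have "(\<Sum>n. cmod (b (n + 1)) * r ^ (n + 1)) \<le> k * A"
    using coanalytic_coeff_sum_bound[OF hol nz dil a b r(1,2)] by (simp add: A_def)
  also have "\<dots> \<le> k * (2 * d * (r / (1 - r)))"
    using A k by (rule mult_left_mono)
  finally have 4: "(\<Sum>n. cmod (b (n + 1)) * r ^ (n + 1)) \<le> k * (2 * d * (r / (1 - r)))" .
  have "2 * K / (K + 1) = 1 + k" using K by (simp add: k_def field_simps)
  then have "d * bohr_majorant K r = 2 * d * (r / (1 - r)) + d * (2 * r / (1 - r)^2)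
      + 2 * d * (r^2 / (1 - r)) + k * (2 * d * (r / (1 - r)))"
    unfolding bohr_majorant_def by (simp add: algebra_simps add_divide_distrib)
  then show ?thesis
    using 1 2 3 4 unfolding r_def[symmetric] d_def[symmetric] by linarith
qed

section \<open>Sharpness: the half-plane map\<close>

text \<open>The inverse map is \<open>w / (1 + w)\<close>, and \<open>cmod w < cmod (1 + w)\<close>
  says that \<open>w\<close> is closer to 0 than to -1, that is, to the right of the perpendicular
  bisector \<open>Re w = - (1/2)\<close>.\<close>

lemma image_halfplane_map:
  "(\<lambda>z. z / (1 - z)) ` unit_disc = {w. Re w > - (1/2)}"
proof -
  have iff: "cmod w < cmod (1 + w) \<longleftrightarrow> Re w > - (1/2)" for w
  proof -
    have "cmod w < cmod (1 + w) \<longleftrightarrow> (cmod w)^2 < (cmod (1 + w))^2"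
      using power_mono_iff[of "cmod (1 + w)" "cmod w" 2] by (simp flip: not_le)
    also have "\<dots> \<longleftrightarrow> 0 < 1 + 2 * Re w"
      unfolding cmod_power2 by (simp add: power2_eq_square algebra_simps)
    also have "\<dots> \<longleftrightarrow> Re w > - (1/2)" by linarith
    finally show ?thesis .
  qed
  show ?thesis
  proof (intro set_eqI iffI)
    fix w assume "w \<in> (\<lambda>z. z / (1 - z)) ` unit_disc"
    then obtain z where z: "cmod z < 1" "w = z / (1 - z)" by auto
    then have "z \<noteq> 1" by auto
    then have "1 + w = 1 / (1 - z)" using z by (simp add: field_simps)
    then have "cmod w < cmod (1 + w)" using z \<open>z \<noteq> 1\<close> by (simp add: norm_divide divide_strict_right_mono)
    then show "w \<in> {w. Re w > - (1/2)}" using iff by simp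
  next
    fix w :: complex assume w: "w \<in> {w. Re w > - (1/2)}"
    then have lt: "cmod w < cmod (1 + w)" using iff by simp
    then have nz: "1 + w \<noteq> 0" by auto
    show "w \<in> (\<lambda>z. z / (1 - z)) ` unit_disc"
    proof (rule image_eqI[of _ _ "w / (1 + w)"])
      show "w / (1 + w) \<in> unit_disc" using lt nz by (simp add: norm_divide divide_less_eq)
      have "1 - w / (1 + w) = 1 / (1 + w)" using nz by (simp add: field_simps)
      then show "w = (w / (1 + w)) / (1 - w / (1 + w))" using nz by simp
    qed
  qed
qed

lemma univalent_convex_halfplane_map: "univalent_convex (\<lambda>z. z / (1 - z))"
  unfolding univalent_convex_def image_halfplane_map
proof (intro conjI convex_halfspace_Re_gt)
  show "(\<lambda>z. z / (1 - z)) holomorphic_on unit_disc"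
    by (intro holomorphic_intros) auto
  show "inj_on (\<lambda>z. z / (1 - z)) unit_disc"
  proof (rule inj_onI)
    fix x y :: complex
    assume "x \<in> unit_disc" "y \<in> unit_disc" and eq: "x / (1 - x) = y / (1 - y)"
    then have "1 - x \<noteq> 0" "1 - y \<noteq> 0" by auto
    then show "x = y" using eq by (simp add: frac_eq_eq algebra_simps)
  qed
qed

text \<open>The frontier point \<open>- (1/2)\<close> is a witness. An upper bound suffices, since a
  counterexample needs a small right-hand side.\<close>

lemma infdist_halfplane_map_le:
  "infdist 0 (frontier ((\<lambda>z. z / (1 - z)) ` unit_disc)) \<le> 1/2"
proof (rule infdist_le2)
  have "frontier {w. Re w > - (1/2)} = {w. Re w = - (1/2)}"
    using frontier_halfspace_gt[of "1::complex" "- (1/2)"] by simp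
  then show "- (1/2) \<in> frontier ((\<lambda>z. z / (1 - z)) ` unit_disc)"
    unfolding image_halfplane_map by simp
qed (simp add: dist_norm)

text \<open>For \<open>h = \<phi>\<close> and \<open>g = k * \<phi>\<close> the dilatation is the
  constant \<open>k\<close>. At the positive point \<open>r\<close> the left-hand side equals half
  the majorant, while the right-hand side is at most \<open>1/2\<close>.\<close>

lemma bohr_inequality_fails:
  assumes K: "K \<ge> 1" and r: "0 < r" "r < 1" and gt: "bohr_majorant K r > 1" and R: "r \<le> R"
  shows "\<not> bohr_inequality_up_to K R"
proof
  define k where "k = (K - 1) / (K + 1)"
  define \<phi> where "\<phi> = (\<lambda>z::complex. z / (1 - z))"
  define g where "g = (\<lambda>z. of_real k * \<phi> z)"
  define a where "a = (\<lambda>n::nat. if n = 0 then 0 else 1 :: complex)"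
  define b where "b = (\<lambda>n::nat. complex_of_real k)"
  have k: "0 \<le> k" "k < 1" using K by (auto simp: k_def)
  have uc: "univalent_convex \<phi>" unfolding \<phi>_def by (rule univalent_convex_halfplane_map)
  then have hol: "\<phi> holomorphic_on unit_disc" by (simp add: univalent_convex_def)
  have der: "(\<phi> has_field_derivative 1 / (1 - z)^2) (at z)" if "z \<in> unit_disc" for z
  proof -
    have "1 - z \<noteq> 0" using that by auto
    then show ?thesis
      unfolding \<phi>_def by (auto intro!: derivative_eq_intros simp: power2_eq_square)
  qed
  have d\<phi>: "deriv \<phi> z = 1 / (1 - z)^2" if "z \<in> unit_disc" for z
    using der[OF that] by (rule DERIV_imp_deriv)
  have nz: "deriv \<phi> z \<noteq> 0" if "z \<in> unit_disc" for z
    using d\<phi>[OF that] that by auto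
  have dil: "dilatation \<phi> g z = of_real k" if "z \<in> unit_disc" for z
  proof -
    have "deriv g z = of_real k * deriv \<phi> z"
      unfolding g_def d\<phi>[OF that] using der[OF that] by (intro DERIV_imp_deriv DERIV_cmult)
    then show ?thesis using nz[OF that] by (simp add: dilatation_def)
  qed
  have qc: "quasiconformal_harmonic K (\<lambda>z. \<phi> z + cnj (g z)) \<phi> g"
    using hol nz dil k
    by (auto simp: quasiconformal_harmonic_def harmonic_mapping_def sense_preserving_def g_def
        simp flip: k_def intro!: holomorphic_intros)
  have geo: "(\<lambda>n. z ^ Suc n) sums \<phi> z" if "z \<in> unit_disc" for z
    using sums_mult[OF geometric_sums, of z z] that by (simp add: \<phi>_def)
  have series: "series_expansion \<phi> g a b"
    unfolding series_expansion_def
  proof (intro ballI conjI)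
    fix z assume z: "z \<in> unit_disc"
    show "(\<lambda>n. a n * z ^ n) sums \<phi> z"
      using geo[OF z] sums_Suc[of "\<lambda>n. a n * z ^ n" "\<phi> z"] by (simp add: a_def)
    show "(\<lambda>n. b (Suc n) * z ^ Suc n) sums g z"
      unfolding b_def g_def by (rule sums_mult[OF geo[OF z]])
  qed
  have sub: "subordinate \<phi> \<phi>"
    unfolding subordinate_def by (intro exI[of _ "\<lambda>z. z"]) auto
  have rin: "complex_of_real r \<in> unit_disc" using r by simp
  assume "bohr_inequality_up_to K R"
  then have "bohr_inequality \<phi> a b \<phi> (of_real r)"
    unfolding bohr_inequality_up_to_def using qc series uc sub rin R r by auto
  then have ineq: "cmod (\<phi> (of_real r)) + cmod (deriv \<phi> (of_real r)) * r
       + (\<Sum>n. r ^ (n + 2)) + (\<Sum>n. k * r ^ (n + 1)) \<le> 1/2"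
    using infdist_halfplane_map_le r k
    by (simp add: bohr_inequality_def a_def b_def \<phi>_def)
  have "cmod (1 - complex_of_real r) = 1 - r"
    using r norm_of_real[of "1 - r", where 'a = complex] by simp
  then have v: "cmod (\<phi> (of_real r)) = r / (1 - r)" "cmod (deriv \<phi> (of_real r)) = 1 / (1 - r)^2"
    unfolding d\<phi>[OF rin] \<phi>_def using r by (simp_all add: norm_divide norm_power)
  have "(\<lambda>n. r ^ 2 * r ^ n) sums (r ^ 2 * (1 / (1 - r)))"
    "(\<lambda>n. k * r * r ^ n) sums (k * r * (1 / (1 - r)))"
    using r by (intro sums_mult geometric_sums; simp)+
  from this[THEN sums_unique]
  have s: "(\<Sum>n. r ^ (n + 2)) = r^2 / (1 - r)" "(\<Sum>n. k * r ^ (n + 1)) = k * r / (1 - r)"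
    by (simp_all add: power_add power2_eq_square mult_ac)
  \<comment> \<open>This identity makes the majorant exactly \<open>2 * X\<close>, with
    \<open>X\<close> the left-hand side of \<open>ineq\<close>.\<close>
  have "2 * K / (K + 1) = 1 + k" using K by (simp add: k_def field_simps)
  then have "bohr_majorant K r = 2 * (r / (1 - r) + 1 / (1 - r)^2 * r + r^2 / (1 - r) + k * r / (1 - r))"
    unfolding bohr_majorant_def by (simp add: algebra_simps add_divide_distrib)
  moreover define X where "X = r / (1 - r) + 1 / (1 - r)^2 * r + r^2 / (1 - r) + k * r / (1 - r)"
  ultimately show False
    using ineq gt unfolding v s X_def[symmetric] by simp
qed

section \<open>Smallest root, validity and sharpness of the radius\<close>

theorem theorem4p3:
  fixes K :: real
  assumes "K \<ge> 1"
  shows "\<exists>r\<^sub>0. 0 < r\<^sub>0 \<and> r\<^sub>0 < 1 \<and> radius_equation K r\<^sub>0 \<and>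
           (\<forall>r. 0 < r \<and> radius_equation K r \<longrightarrow> r\<^sub>0 \<le> r) \<and>
           bohr_inequality_up_to K r\<^sub>0 \<and>
           (\<forall>R>r\<^sub>0. \<not> bohr_inequality_up_to K R)"
proof -
  obtain r\<^sub>0 where r\<^sub>0: "0 < r\<^sub>0" "r\<^sub>0 < 1/3" "bohr_majorant K r\<^sub>0 = 1"
    using bohr_radius_exists[OF assms] .
  note mono = bohr_majorant_strict_mono[OF assms]
  have "r\<^sub>0 \<le> r" if r: "0 < r" "radius_equation K r" for r
  proof (rule ccontr)
    assume "\<not> r\<^sub>0 \<le> r"
    then show False using r r\<^sub>0 mono[of r r\<^sub>0] radius_equation_iff[of r K] by simp
  qed
  moreover have "bohr_inequality_up_to K r\<^sub>0"
    unfolding bohr_inequality_up_to_def bohr_inequality_def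
  proof (intro allI impI ballI)
    fix f h g a b \<phi> and z :: complex
    assume *: "quasiconformal_harmonic K f h g" "series_expansion h g a b"
      "univalent_convex \<phi>" "subordinate h \<phi>" and z: "cmod z \<le> r\<^sub>0"
    have "bohr_majorant K (cmod z) \<le> 1"
      using mono[of "cmod z" r\<^sub>0] z r\<^sub>0 by (cases "cmod z = r\<^sub>0") auto
    then have "infdist (\<phi> 0) (frontier (\<phi> ` unit_disc)) * bohr_majorant K (cmod z)
        \<le> infdist (\<phi> 0) (frontier (\<phi> ` unit_disc))"
      by (rule mult_left_le) (rule infdist_nonneg)
    then show "cmod (h z) + cmod (deriv h z) * cmod z
       + (\<Sum>n. cmod (a (n + 2)) * cmod z ^ (n + 2))
       + (\<Sum>n. cmod (b (n + 1)) * cmod z ^ (n + 1))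
     \<le> cmod (\<phi> 0) + infdist (\<phi> 0) (frontier (\<phi> ` unit_disc))"
      using bohr_sum_le_majorant[OF assms *, of z] z r\<^sub>0 by linarith
  qed
  moreover have "\<not> bohr_inequality_up_to K R" if "R > r\<^sub>0" for R
  proof -
    \<comment> \<open>\<open>R\<close> may exceed 1, but the point where the inequality fails must
      lie in the unit disc.\<close>
    have "r\<^sub>0 < min R 1" using that r\<^sub>0 by simp
    then obtain r where "r\<^sub>0 < r" "r < min R 1" using dense by blast
    then show ?thesis
      using bohr_inequality_fails[OF assms, of r R] mono[of r\<^sub>0 r] r\<^sub>0 by auto
  qed
  ultimately show ?thesis
    using r\<^sub>0 radius_equation_iff[of r\<^sub>0 K] by (intro exI[of _ r\<^sub>0]) auto
qed

end
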